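(* Let $X$ be a real Banach space, let $C\subset X$ be a closed convex set and let $M$ be a metric space. Let $f\colon C\to M$ be a dentable map which is uniformly continuous on bounded subsets of $C$. Then for every nonempty bounded $A\subset C$, the set $\mathcal{SS}(f,A)$ of all $f$-strongly slicing functionals on $A$ is a dense $\mathcal G_\delta$ subset of $X^*$ (for the norm topology of $X^*$).
   Context: An open half-space of $X$ is a set $\{x\in X: x^*(x)>a\}$ with $x^*\in X^*$, $a\in\mathbb R$. A map $f\colon C\to M$ is dentable if for every nonempty bounded set $A\subset C$ and every $\varepsilon>0$ there is an open half-space $H$ such that $A\cap H\neq\emptyset$ and $\operatorname{diam}(f(A\cap H))<\varepsilon$. For $A\subset X$ bounded and nonempty, $x^*\in X^*$ and $t>0$, put $S(A,x^*,t)=\{x\in A: x^*(x)>\sup_{A}x^*-t\}$. A functional $x^*\in X^*$ is $f$-strongly slicing on $A\subset C$ if $\lim_{t\to0^+}\operatorname{diam}(f(S(A,x^*,t)))=0$; $\mathcal{SS}(f,A)$ denotes the set of all such $x^*$. *)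

theory Defs
  imports "HOL-Analysis.Analysis"
begin

definition open_half_space :: "'a::real_normed_vector set \<Rightarrow> bool" where
  "open_half_space H \<longleftrightarrow> (\<exists>(\<phi> :: 'a \<Rightarrow>\<^sub>L real) a. H = {x. blinfun_apply \<phi> x > a})"

(* The library's real-valued diameter is unspecified on unbounded sets, whereas mathematically
   their diameter is infinite. The boundedness conjuncts in the two definitions below rule
   this case out. *)

definition dentable_on :: "'a::real_normed_vector set \<Rightarrow> ('a \<Rightarrow> 'b::metric_space) \<Rightarrow> bool" where
  "dentable_on C f \<longleftrightarrow>
     (\<forall>A \<epsilon>. A \<noteq> {} \<and> bounded A \<and> A \<subseteq> C \<and> \<epsilon> > 0 \<longrightarrow>
        (\<exists>H. open_half_space H \<and> A \<inter> H \<noteq> {} \<and>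
             bounded (f ` (A \<inter> H)) \<and> diameter (f ` (A \<inter> H)) < \<epsilon>))"

definition slice :: "'a::real_normed_vector set \<Rightarrow> ('a \<Rightarrow>\<^sub>L real) \<Rightarrow> real \<Rightarrow> 'a set" where
  "slice A \<phi> t = {x \<in> A. blinfun_apply \<phi> x > (SUP y\<in>A. blinfun_apply \<phi> y) - t}"

definition strongly_slicing ::
    "('a::real_normed_vector \<Rightarrow> 'b::metric_space) \<Rightarrow> 'a set \<Rightarrow> ('a \<Rightarrow>\<^sub>L real) \<Rightarrow> bool" where
  "strongly_slicing f A \<phi> \<longleftrightarrow>
     (\<forall>\<^sub>F t in at_right 0. bounded (f ` slice A \<phi> t)) \<and>
     ((\<lambda>t. diameter (f ` slice A \<phi> t)) \<longlongrightarrow> 0) (at_right 0)"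

definition SS :: "('a::real_normed_vector \<Rightarrow> 'b::metric_space) \<Rightarrow> 'a set \<Rightarrow> ('a \<Rightarrow>\<^sub>L real) set" where
  "SS f A = {\<phi>. strongly_slicing f A \<phi>}"

end

theory Submission
  imports Defs
begin

text \<open>
  The functionals with a slice of oscillation at most \<open>\<epsilon>\<close> form an open set, so by Baire's theorem only
  its density is at stake. A slice of \<open>A\<close> lies in the corresponding slice of its closed convex
  hull, so \<open>A\<close> may be replaced by a closed bounded convex set \<open>D\<close>. Given a ball \<open>U\<close> in the dual, apply
  dentability to the set \<open>S\<close> of points at which some functional of \<open>U\<close> attains its maximum over \<open>D\<close>:
  a half-space \<open>{\<phi> > a}\<close> cuts off from \<open>S\<close> a piece containing a point \<open>z\<close> and with small image. If
  \<open>y \<in> U\<close> attains its maximum at \<open>z\<close>, then for small \<open>\<eta> > 0\<close> the functional \<open>y + \<eta>\<phi>\<close> is still in \<open>U\<close>, and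
  its thin slices lie well inside \<open>{\<phi> > a}\<close>. By the Bishop--Phelps--Bollobas theorem the points of
  a thin slice are close to points of \<open>S\<close>, hence close to the piece with small image, and uniform
  continuity finishes the argument.
\<close>

section \<open>A sandwich form of the Hahn--Banach theorem\<close>

text \<open>Homogeneity is only an inequality for \<open>c > 0\<close>, which is what infima of such
  functions directly inherit. Equality follows by applying it to \<open>inverse c\<close> as
  well.\<close>

definition sublinear :: "('a::real_vector \<Rightarrow> real) \<Rightarrow> bool" where
  "sublinear q \<longleftrightarrow> (\<forall>x y. q (x + y) \<le> q x + q y) \<and> (\<forall>c>0. \<forall>x. q (c *\<^sub>R x) \<le> c * q x)"

lemma sublinear_add: "sublinear q \<Longrightarrow> q (x + y) \<le> q x + q y"
  and sublinear_scale_le: "sublinear q \<Longrightarrow> c > 0 \<Longrightarrow> q (c *\<^sub>R x) \<le> c * q x"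
  by (auto simp: sublinear_def)

lemma sublinear_0:
  assumes "sublinear q" shows "q 0 = 0"
  using sublinear_add[OF assms, of 0 0] sublinear_scale_le[OF assms, of "1/2" 0] by simp

lemma sublinear_scale:
  assumes "sublinear q" "c \<ge> 0" shows "q (c *\<^sub>R x) = c * q x"
proof (cases "c = 0")
  case False
  then have "c > 0" using assms by simp
  have "q x \<le> inverse c * q (c *\<^sub>R x)"
    using sublinear_scale_le[OF assms(1), of "inverse c" "c *\<^sub>R x"] \<open>c > 0\<close> by simp
  then have "c * q x \<le> q (c *\<^sub>R x)"
    using \<open>c > 0\<close> by (simp add: field_simps)
  then show ?thesis
    using sublinear_scale_le[OF assms(1) \<open>c > 0\<close>, of x] by simp
qed (simp add: sublinear_0[OF assms(1)])

lemma sublinear_ge_uminus: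
  assumes "sublinear q" shows "- q (- x) \<le> q x"
  using sublinear_add[OF assms, of x "- x"] sublinear_0[OF assms] by simp

text \<open>Take \<open>r x\<close> to be the infimum of \<open>q (x + k) - h k\<close> over the
  cone. It is finite because \<open>h k \<le> q k \<le> q (x + k) + q (- x)\<close>. A linear
  functional below \<open>r\<close> automatically dominates \<open>h\<close> on \<open>K\<close>, so
  \<open>r\<close> turns a lower constraint into an upper one.\<close>

lemma sublinear_lower_by_cone:
  fixes q h :: "'a::real_vector \<Rightarrow> real"
  assumes q: "sublinear q"
    and K0: "0 \<in> K" and Kadd: "\<And>k l. k \<in> K \<Longrightarrow> l \<in> K \<Longrightarrow> k + l \<in> K"
    and Kscale: "\<And>c k. c > 0 \<Longrightarrow> k \<in> K \<Longrightarrow> c *\<^sub>R k \<in> K"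
    and h0: "h 0 = 0" and hadd: "\<And>k l. k \<in> K \<Longrightarrow> l \<in> K \<Longrightarrow> h k + h l \<le> h (k + l)"
    and hscale: "\<And>c k. c > 0 \<Longrightarrow> k \<in> K \<Longrightarrow> c * h k \<le> h (c *\<^sub>R k)"
    and hq: "\<And>k. k \<in> K \<Longrightarrow> h k \<le> q k"
  obtains r where "sublinear r" "\<And>x. r x \<le> q x" "\<And>x k. k \<in> K \<Longrightarrow> r x \<le> q (x + k) - h k"
proof -
  define r where "r x = (INF k\<in>K. q (x + k) - h k)" for x
  have bdd: "bdd_below ((\<lambda>k. q (x + k) - h k) ` K)" for x
  proof (rule bdd_belowI2)
    fix k assume "k \<in> K"
    then show "- q (- x) \<le> q (x + k) - h k"
      using hq[of k] sublinear_add[OF q, of "- x" "x + k"] by simp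
  qed
  have lower: "r x \<le> q (x + k) - h k" if "k \<in> K" for x k
    unfolding r_def by (rule cINF_lower[OF bdd that])
  have greatest: "b \<le> r x" if "\<And>k. k \<in> K \<Longrightarrow> b \<le> q (x + k) - h k" for b x
    unfolding r_def using K0 that by (intro cINF_greatest) auto
  have "r (x + y) \<le> r x + r y" for x y
  proof -
    have *: "r (x + y) \<le> (q (x + k) - h k) + (q (y + l) - h l)" if "k \<in> K" "l \<in> K" for k l
      using lower[OF Kadd[OF that], of "x + y"] hadd[OF that]
        sublinear_add[OF q, of "x + k" "y + l"] by (simp add: algebra_simps)
    have "r (x + y) - (q (x + k) - h k) \<le> r y" if "k \<in> K" for k
      by (rule greatest) (use *[OF that] in \<open>simp add: algebra_simps\<close>)
    then have "r (x + y) - r y \<le> r x"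
      by (intro greatest) (simp add: algebra_simps)
    then show ?thesis by simp
  qed
  moreover have "r (c *\<^sub>R x) \<le> c * r x" if "c > 0" for c x
  proof -
    have "r (c *\<^sub>R x) / c \<le> r x"
    proof (rule greatest)
      fix k assume k: "k \<in> K"
      have "r (c *\<^sub>R x) \<le> q (c *\<^sub>R (x + k)) - h (c *\<^sub>R k)"
        using lower[OF Kscale[OF that k]] by (simp add: scaleR_add_right)
      also have "\<dots> \<le> c * (q (x + k) - h k)"
        using hscale[OF that k] sublinear_scale_le[OF q that, of "x + k"]
        by (simp add: right_diff_distrib)
      finally show "r (c *\<^sub>R x) / c \<le> q (x + k) - h k"
        using that by (simp add: field_simps)
    qed
    then show ?thesis using that by (simp add: field_simps)
  qed
  ultimately have "sublinear r" by (auto simp: sublinear_def)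
  moreover have "r x \<le> q x" for x using lower[OF K0, of x] h0 by simp
  ultimately show thesis using lower that by blast
qed

text \<open>Zorn's lemma applies because the pointwise infimum of a nonempty chain is again
  sublinear. It is finite since each member satisfies
  \<open>a x \<ge> - a (- x) \<ge> - p (- x)\<close>.\<close>

lemma exists_minimal_sublinear:
  assumes p: "sublinear p"
  obtains q where "sublinear q" "\<And>x. q x \<le> p x"
    "\<And>r. sublinear r \<Longrightarrow> (\<And>x. r x \<le> q x) \<Longrightarrow> r = q"
proof -
  define A where "A = {q. sublinear q \<and> (\<forall>x. q x \<le> p x)}"
  \<comment> \<open>The order is reversed, so that a maximal element for \<open>P\<close> is a
    pointwise minimal functional.\<close>
  define P :: "('a \<Rightarrow> real) \<Rightarrow> ('a \<Rightarrow> real) \<Rightarrow> bool" where "P q r \<longleftrightarrow> r \<le> q" for q r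
  have po: "partial_order_on A (relation_of P A)"
    by (rule partial_order_on_relation_ofI) (auto simp: P_def)
  have "\<exists>u\<in>A. \<forall>a\<in>C. P a u" if C: "C \<in> Chains (relation_of P A)" for C
  proof (cases "C = {}")
    case True
    then show ?thesis using p by (auto simp: A_def)
  next
    case False
    have total: "a \<le> b \<or> b \<le> a" if "a \<in> C" "b \<in> C" for a b
      using C that by (auto simp: Chains_def relation_of_def P_def)
    have CA: "C \<subseteq> A"
      using C by (auto simp: Chains_def relation_of_def)
    define u where "u x = (INF a\<in>C. a x)" for x
    have bdd: "bdd_below ((\<lambda>a. a x) ` C)" for x
    proof (rule bdd_belowI2)
      fix a assume "a \<in> C"
      then have "sublinear a" "a (- x) \<le> p (- x)" using CA by (auto simp: A_def)
      then show "- p (- x) \<le> a x" using sublinear_ge_uminus[of a x] by simp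
    qed
    have lower: "u x \<le> a x" if "a \<in> C" for a x
      unfolding u_def by (rule cINF_lower[OF bdd that])
    have greatest: "b \<le> u x" if "\<And>a. a \<in> C \<Longrightarrow> b \<le> a x" for b x
      unfolding u_def using False that by (intro cINF_greatest) auto
    have "u (x + y) \<le> u x + u y" for x y
    proof -
      \<comment> \<open>Subadditivity can only be used for a single functional. In a chain the
        smaller of \<open>a\<close> and \<open>b\<close> serves for both arguments.\<close>
      have *: "u (x + y) \<le> a x + b y" if ab: "a \<in> C" "b \<in> C" for a b
      proof -
        obtain c where c: "c \<in> C" "c \<le> a" "c \<le> b"
          using total[OF ab] ab by auto
        then have "sublinear c" using CA by (auto simp: A_def)
        then have "u (x + y) \<le> c x + c y"
          using lower[OF c(1), of "x + y"] sublinear_add[of c x y] by simp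
        then show ?thesis using c(2,3)[THEN le_funD] by (meson add_mono order_trans)
      qed
      have "u (x + y) - a x \<le> u y" if "a \<in> C" for a
        by (rule greatest) (use *[OF that] in \<open>simp add: algebra_simps\<close>)
      then have "u (x + y) - u y \<le> u x"
        by (intro greatest) (simp add: algebra_simps)
      then show ?thesis by simp
    qed
    moreover have "u (c *\<^sub>R x) \<le> c * u x" if "c > 0" for c x
    proof -
      have "u (c *\<^sub>R x) / c \<le> u x"
      proof (rule greatest)
        fix a assume a: "a \<in> C"
        then have "sublinear a" using CA by (auto simp: A_def)
        then have "u (c *\<^sub>R x) \<le> c * a x"
          using lower[OF a, of "c *\<^sub>R x"] sublinear_scale_le[of a c x] that by simp
        then show "u (c *\<^sub>R x) / c \<le> a x" using that by (simp add: field_simps)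
      qed
      then show ?thesis using that by (simp add: field_simps)
    qed
    ultimately have "sublinear u" by (auto simp: sublinear_def)
    moreover obtain a where "a \<in> C" using False by auto
    then have "u x \<le> p x" for x
      using lower[of a x] CA unfolding A_def by (metis (mono_tags, lifting) mem_Collect_eq order_trans subsetD)
    ultimately show ?thesis using lower by (auto simp: A_def P_def le_fun_def)
  qed
  from predicate_Zorn[OF po this] obtain m where m: "m \<in> A" "\<And>a. a \<in> A \<Longrightarrow> P m a \<Longrightarrow> a = m"
    by blast
  show thesis
  proof (rule that)
    show "sublinear m" "m x \<le> p x" for x using m(1) by (auto simp: A_def)
    fix r assume "sublinear r" "\<And>x. r x \<le> m x"
    then show "r = m"
      using m(1) by (intro m(2)) (auto simp: A_def P_def le_fun_def intro: order_trans)
  qed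
qed

lemma minimal_sublinear_imp_linear:
  assumes q: "sublinear q" and min: "\<And>r. sublinear r \<Longrightarrow> (\<And>x. r x \<le> q x) \<Longrightarrow> r = q"
  shows "linear q"
proof -
  have add: "q (x + y) = q x + q y" for x y
  proof (rule antisym)
    txt \<open>By minimality, lowering \<open>q\<close> along the ray through \<open>y\<close> does not change it.\<close>
    define K where "K = (\<lambda>t. t *\<^sub>R y) ` {0..}"
    obtain r where r: "sublinear r" "\<And>x. r x \<le> q x" "\<And>x k. k \<in> K \<Longrightarrow> r x \<le> q (x + k) - q k"
    proof (rule sublinear_lower_by_cone[OF q, of K q])
      show "0 \<in> K" by (auto simp: K_def image_iff intro: bexI[of _ 0])
      show "k + l \<in> K" if "k \<in> K" "l \<in> K" for k l
        using that by (auto simp: K_def scaleR_add_left[symmetric])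
      show "c *\<^sub>R k \<in> K" if "c > 0" "k \<in> K" for c k
        using that by (auto simp: K_def)
      show "q k + q l \<le> q (k + l)" if "k \<in> K" "l \<in> K" for k l
      proof -
        obtain s t where k: "k = s *\<^sub>R y" "s \<ge> 0" and l: "l = t *\<^sub>R y" "t \<ge> 0"
          using \<open>k \<in> K\<close> \<open>l \<in> K\<close> by (auto simp: K_def)
        have "q (k + l) = (s + t) * q y"
          using sublinear_scale[OF q, of "s + t" y] k l by (simp add: scaleR_add_left)
        then show ?thesis
          using k l by (simp add: sublinear_scale[OF q] distrib_right)
      qed
    qed (use q in \<open>auto simp: sublinear_0 sublinear_scale\<close>)
    \<comment> \<open>Since \<open>r = q\<close>, the bound on \<open>r\<close> at
      \<open>k = y\<close> reads \<open>q x \<le> q (x + y) - q y\<close>, which is the missing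
      superadditivity.\<close>
    have "y \<in> K" by (auto simp: K_def image_iff intro: bexI[of _ 1])
    then show "q x + q y \<le> q (x + y)"
      using r(3)[of y x] min[OF r(1,2)] by simp
  qed (rule sublinear_add[OF q])
  have neg: "q (- x) = - q x" for x
    using add[of x "- x"] sublinear_0[OF q] by simp
  show ?thesis
  proof (rule linearI)
    show "q (c *\<^sub>R x) = c *\<^sub>R q x" for c x
      using sublinear_scale[OF q, of c x] sublinear_scale[OF q, of "- c" x] neg[of "c *\<^sub>R x"]
      by (cases "c \<ge> 0") auto
  qed (rule add)
qed

text \<open>Lower \<open>q\<close> along the cone to \<open>r\<close>, then descend to a minimal,
  hence linear, \<open>g\<close>. Evaluating at \<open>- k\<close> gives
  \<open>g (- k) \<le> r (- k) \<le> q 0 - h k = - h k\<close>.\<close>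

theorem hahn_banach_sandwich:
  fixes q h :: "'a::real_vector \<Rightarrow> real"
  assumes q: "sublinear q"
    and K0: "0 \<in> K" and Kadd: "\<And>k l. k \<in> K \<Longrightarrow> l \<in> K \<Longrightarrow> k + l \<in> K"
    and Kscale: "\<And>c k. c > 0 \<Longrightarrow> k \<in> K \<Longrightarrow> c *\<^sub>R k \<in> K"
    and h0: "h 0 = 0" and hadd: "\<And>k l. k \<in> K \<Longrightarrow> l \<in> K \<Longrightarrow> h k + h l \<le> h (k + l)"
    and hscale: "\<And>c k. c > 0 \<Longrightarrow> k \<in> K \<Longrightarrow> c * h k \<le> h (c *\<^sub>R k)"
    and hq: "\<And>k. k \<in> K \<Longrightarrow> h k \<le> q k"
  obtains g where "linear g" "\<And>x. g x \<le> q x" "\<And>k. k \<in> K \<Longrightarrow> h k \<le> g k"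
proof -
  obtain r where r: "sublinear r" "\<And>x. r x \<le> q x" "\<And>x k. k \<in> K \<Longrightarrow> r x \<le> q (x + k) - h k"
    using sublinear_lower_by_cone[OF assms] by blast
  obtain g where g: "sublinear g" "\<And>x. g x \<le> r x"
    and min: "\<And>s. sublinear s \<Longrightarrow> (\<And>x. s x \<le> g x) \<Longrightarrow> s = g"
    using exists_minimal_sublinear[OF r(1)] by blast
  have "linear g" using minimal_sublinear_imp_linear[OF g(1) min] .
  moreover have "h k \<le> g k" if "k \<in> K" for k
    using r(3)[OF that, of "- k"] g(2)[of "- k"] sublinear_0[OF q] linear_neg[OF \<open>linear g\<close>, of k]
    by simp
  ultimately show thesis using g(2) r(2) that by (meson order_trans)
qed

section \<open>The Bishop--Phelps--Bollobas theorem\<close>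

text \<open>This is Ekeland's variational principle for \<open>- \<psi>\<close>. The relation
  \<open>v \<in> S z\<close> is transitive by the triangle inequality. A sequence climbing almost
  optimally in this order converges by completeness, and \<open>\<psi>\<close> is greatest on
  \<open>S z\<close> at its limit \<open>z\<close>.\<close>

lemma ekeland_functional:
  fixes D :: "'a::banach set" and \<psi> :: "'a \<Rightarrow>\<^sub>L real"
  assumes "closed D" "w \<in> D" "bdd_above (\<psi> ` D)" "\<beta> > 0"
  obtains z where "z \<in> D" "\<psi> w + \<beta> * norm (z - w) \<le> \<psi> z"
    "\<And>v. v \<in> D \<Longrightarrow> \<psi> v \<le> \<psi> z + \<beta> * norm (v - z)"
proof -
  define S where "S z = {v\<in>D. \<psi> z + \<beta> * norm (v - z) \<le> \<psi> v}" for z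
  have S_self: "z \<in> S z" if "z \<in> D" for z using that by (simp add: S_def)
  have S_trans: "S v \<subseteq> S z" if v: "v \<in> S z" for v z
  proof
    fix u assume u: "u \<in> S v"
    have "\<beta> * norm (u - z) \<le> \<beta> * (norm (u - v) + norm (v - z))"
      using norm_triangle_ineq[of "u - v" "v - z"] assms(4) by (intro mult_left_mono) auto
    then show "u \<in> S z" using u v by (auto simp: S_def algebra_simps)
  qed
  have S_closed: "closed (S z)" for z
  proof -
    have "S z = D \<inter> {v. \<psi> z + \<beta> * norm (v - z) \<le> \<psi> v}" by (auto simp: S_def)
    then show ?thesis
      by (auto intro!: closed_Int assms closed_Collect_le continuous_intros)
  qed
  have bdd: "bdd_above (\<psi> ` S z)" for z
    by (rule bdd_above_mono[OF assms(3)]) (auto simp: S_def)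
  have step: "\<exists>v. v \<in> S z \<and> (\<forall>u\<in>S z. \<psi> u \<le> \<psi> v + (1/2)^n)" if zD: "z \<in> D" for z and n :: nat
  proof -
    have "(SUP u\<in>S z. \<psi> u) - (1/2)^n < (SUP u\<in>S z. \<psi> u)" by simp
    then obtain v where v: "v \<in> S z" "(SUP u\<in>S z. \<psi> u) - (1/2)^n < \<psi> v"
      using less_cSUP_iff[OF _ bdd] S_self[OF zD] by (metis empty_iff)
    moreover have "\<psi> u \<le> (SUP u\<in>S z. \<psi> u)" if "u \<in> S z" for u
      by (rule cSUP_upper[OF that bdd])
    ultimately show ?thesis by force
  qed
  \<comment> \<open>The next point nearly maximizes \<open>\<psi>\<close> over \<open>S z\<close>,
    with an error that tends to 0.\<close>
  define Z where "Z = rec_nat w (\<lambda>n z. SOME v. v \<in> S z \<and> (\<forall>u\<in>S z. \<psi> u \<le> \<psi> v + (1/2)^n))"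
  have Z0: "Z 0 = w" by (simp add: Z_def)
  have Z_Suc: "Z (Suc n) \<in> S (Z n) \<and> (\<forall>u\<in>S (Z n). \<psi> u \<le> \<psi> (Z (Suc n)) + (1/2)^n)"
    if "Z n \<in> D" for n
    using someI_ex[OF step[OF that, of n]] by (simp add: Z_def)
  have ZD: "Z n \<in> D" for n
  proof (induction n)
    case (Suc n)
    then show ?case using Z_Suc[OF Suc] by (simp add: S_def)
  qed (simp add: Z0 assms)
  have nested: "S (Z n) \<subseteq> S (Z m)" if "m \<le> n" for m n
    by (rule lift_Suc_antimono_le[OF _ that]) (use Z_Suc[OF ZD] S_trans in blast)
  have Z_mem: "Z n \<in> S (Z m)" if "m \<le> n" for m n
    using nested[OF that] S_self[OF ZD] by blast
  have mono: "incseq (\<lambda>n. \<psi> (Z n))"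
  proof (rule incseq_SucI)
    fix n
    have "\<psi> (Z n) + \<beta> * norm (Z (Suc n) - Z n) \<le> \<psi> (Z (Suc n))"
      using Z_mem[of n "Suc n"] by (simp add: S_def)
    moreover have "0 \<le> \<beta> * norm (Z (Suc n) - Z n)" using assms(4) by simp
    ultimately show "\<psi> (Z n) \<le> \<psi> (Z (Suc n))" by linarith
  qed
  moreover obtain b where "\<And>v. v \<in> D \<Longrightarrow> \<psi> v \<le> b"
    using assms(3) by (auto simp: bdd_above_def)
  ultimately obtain l where "(\<lambda>n. \<psi> (Z n)) \<longlonglongrightarrow> l"
    using incseq_convergent[of "\<lambda>n. \<psi> (Z n)" b] ZD by metis
  then have Cauchy_\<psi>: "Cauchy (\<lambda>n. \<psi> (Z n))" by (rule LIMSEQ_imp_Cauchy)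
  \<comment> \<open>Up to the factor \<open>\<beta>\<close>, distances between the
    \<open>Z n\<close> are bounded by increments of the convergent sequence
    \<open>\<psi> (Z n)\<close>.\<close>
  have "Cauchy Z"
  proof (rule CauchyI')
    fix e :: real assume "e > 0"
    then have "\<beta> * e > 0" using assms(4) by simp
    then obtain M where M: "\<And>m n. m \<ge> M \<Longrightarrow> n \<ge> M \<Longrightarrow> norm (\<psi> (Z m) - \<psi> (Z n)) < \<beta> * e"
      using CauchyD[OF Cauchy_\<psi>] by blast
    have "norm (Z m - Z n) < e" if "m \<ge> M" "n > m" for m n
    proof -
      have "\<beta> * norm (Z n - Z m) \<le> \<psi> (Z n) - \<psi> (Z m)"
        using Z_mem[of m n] that by (simp add: S_def)
      also have "\<dots> < \<beta> * e" using M[of n m] that by simp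
      finally show ?thesis using assms(4) by (simp add: norm_minus_commute)
    qed
    then show "\<exists>M. \<forall>m\<ge>M. \<forall>n>m. dist (Z m) (Z n) < e" by (auto simp: dist_norm)
  qed
  then obtain z where z: "Z \<longlonglongrightarrow> z" using Cauchy_convergent convergent_def by blast
  have zS: "z \<in> S (Z n)" for n
    by (rule closed_sequentially[OF S_closed _ LIMSEQ_ignore_initial_segment[OF z, of n]])
       (simp add: Z_mem)
  show thesis
  proof
    show "z \<in> D" "\<psi> w + \<beta> * norm (z - w) \<le> \<psi> z"
      using zS[of 0] by (auto simp: S_def Z0)
    fix v assume v: "v \<in> D"
    show "\<psi> v \<le> \<psi> z + \<beta> * norm (v - z)"
    \<comment> \<open>A point of \<open>S z\<close> lies in every \<open>S (Z n)\<close>, so it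
      exceeds the value at \<open>z\<close> by at most \<open>(1/2)^n\<close> for all
      \<open>n\<close>. Outside \<open>S z\<close> the inequality is the failure of
      membership.\<close>
    proof (cases "v \<in> S z")
      case True
      have "\<psi> v \<le> \<psi> z + (1/2)^n" for n
      proof -
        have "v \<in> S (Z n)" using True S_trans[OF zS] by blast
        then have "\<psi> v \<le> \<psi> (Z (Suc n)) + (1/2)^n" using Z_Suc[OF ZD] by blast
        moreover have "0 \<le> \<beta> * norm (z - Z (Suc n))" using assms(4) by simp
        ultimately show ?thesis using zS[of "Suc n"] by (simp add: S_def)
      qed
      moreover have "(\<lambda>n. \<psi> z + (1/2)^n) \<longlonglongrightarrow> \<psi> z + 0"
        by (intro tendsto_intros) simp
      ultimately have "\<psi> v \<le> \<psi> z"
        using LIMSEQ_le_const by fastforce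
      moreover have "0 \<le> \<beta> * norm (v - z)" using assms(4) by simp
      ultimately show ?thesis by linarith
    qed (use v in \<open>auto simp: S_def\<close>)
  qed
qed

text \<open>At the Ekeland point \<open>z\<close>, \<open>\<psi>\<close> is at most
  \<open>\<beta>\<close> times the norm on the cone \<open>K\<close> generated by
  \<open>D - z\<close>. The sandwich theorem yields a linear \<open>g\<close> with
  \<open>\<psi> \<le> g\<close> on \<open>K\<close> and \<open>g\<close> below
  \<open>\<beta>\<close> times the norm everywhere. Then \<open>\<psi> - g\<close> is nonpositive on
  \<open>D - z\<close>, so it is maximal at \<open>z\<close>.\<close>

theorem bishop_phelps_bollobas:
  fixes D :: "'a::banach set" and \<psi> :: "'a \<Rightarrow>\<^sub>L real"
  assumes "closed D" "convex D" "w \<in> D" "\<beta> > 0"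
    and near_sup: "\<And>v. v \<in> D \<Longrightarrow> \<psi> v \<le> \<psi> w + \<beta>\<^sup>2"
  obtains z \<phi> where "z \<in> D" "norm (z - w) \<le> \<beta>" "norm (\<phi> - \<psi>) \<le> \<beta>"
    "\<And>v. v \<in> D \<Longrightarrow> blinfun_apply \<phi> v \<le> \<phi> z"
proof -
  have bdd: "bdd_above (\<psi> ` D)" using near_sup by (auto simp: bdd_above_def)
  obtain z where z: "z \<in> D" "\<psi> w + \<beta> * norm (z - w) \<le> \<psi> z"
    and zmax: "\<And>v. v \<in> D \<Longrightarrow> \<psi> v \<le> \<psi> z + \<beta> * norm (v - z)"
    using ekeland_functional[OF assms(1,3) bdd assms(4)] by blast
  \<comment> \<open>The gap \<open>\<beta>\<^sup>2\<close> is \<open>\<beta>\<close> times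
    \<open>\<beta>\<close>: one factor is the slope in Ekeland's principle, the other is left for
    the displacement.\<close>
  have "\<beta> * norm (z - w) \<le> \<beta> * \<beta>"
    using z near_sup[OF z(1)] by (simp add: power2_eq_square)
  then have near: "norm (z - w) \<le> \<beta>" using assms(4) by simp
  define K where "K = {c *\<^sub>R (v - z) |c v. c \<ge> 0 \<and> v \<in> D}"
  have K_I: "c *\<^sub>R (v - z) \<in> K" if "c \<ge> 0" "v \<in> D" for c v
    using that by (auto simp: K_def)
  obtain g where g: "linear g" "\<And>x. g x \<le> \<beta> * norm x" "\<And>k. k \<in> K \<Longrightarrow> \<psi> k \<le> g k"
  proof (rule hahn_banach_sandwich[of "\<lambda>x. \<beta> * norm x" K "blinfun_apply \<psi>"])
    show "sublinear (\<lambda>x. \<beta> * norm (x::'a))"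
      using assms(4) norm_triangle_ineq
      by (auto simp: sublinear_def distrib_left[symmetric])
    show "0 \<in> K" using K_I[of 0 z] z by simp
    show "k + l \<in> K" if kl: "k \<in> K" "l \<in> K" for k l
    proof -
      obtain c u where k: "k = c *\<^sub>R (u - z)" "c \<ge> 0" "u \<in> D" using kl(1) by (auto simp: K_def)
      obtain d v where l: "l = d *\<^sub>R (v - z)" "d \<ge> 0" "v \<in> D" using kl(2) by (auto simp: K_def)
      show ?thesis
      \<comment> \<open>Normalizing to a convex combination divides by \<open>c + d\<close>; if this
        is 0, then \<open>k\<close> is the vertex 0.\<close>
      proof (cases "c + d = 0")
        case True
        then have "c = 0" using k l by simp
        then show ?thesis using kl k by simp
      next
        case False
        let ?u = "(c / (c + d)) *\<^sub>R u + (d / (c + d)) *\<^sub>R v"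
        have "?u \<in> D"
          using False k l by (intro convexD[OF assms(2)]) (auto simp: add_divide_distrib[symmetric])
        moreover have "(c + d) *\<^sub>R ?u = c *\<^sub>R u + d *\<^sub>R v"
          using False by (simp add: scaleR_add_right)
        then have "k + l = (c + d) *\<^sub>R (?u - z)"
          unfolding scaleR_diff_right by (simp add: k l algebra_simps)
        ultimately show ?thesis using K_I[of "c + d" ?u] k l by simp
      qed
    qed
    show "c *\<^sub>R k \<in> K" if ck: "c > 0" "k \<in> K" for c k
    proof -
      obtain d v where "k = d *\<^sub>R (v - z)" "d \<ge> 0" "v \<in> D" using ck(2) by (auto simp: K_def)
      then show ?thesis using K_I[of "c * d" v] ck by simp
    qed
    show "\<psi> k \<le> \<beta> * norm k" if kK: "k \<in> K" for k
    proof -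
      obtain c v where k: "k = c *\<^sub>R (v - z)" "c \<ge> 0" "v \<in> D" using kK by (auto simp: K_def)
      have "c * \<psi> (v - z) \<le> c * (\<beta> * norm (v - z))"
        using zmax[OF k(3)] k(2) by (intro mult_left_mono) (auto simp: blinfun.diff_right)
      then show ?thesis using k by (simp add: blinfun.scaleR_right mult.left_commute)
    qed
  qed (auto simp: blinfun.add_right blinfun.scaleR_right)
  have g_bound: "norm (g x) \<le> \<beta> * norm x" for x
    using g(2)[of x] g(2)[of "- x"] linear_neg[OF g(1), of x] by (auto simp: abs_le_iff)
  have bl: "bounded_linear g"
    using g(1) g_bound by (intro bounded_linear_intro[where K = \<beta>])
      (auto simp: linear_add linear_scale mult.commute)
  define G where "G = Blinfun g"
  have G: "blinfun_apply G = g" unfolding G_def by (rule bounded_linear_Blinfun_apply[OF bl])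
  show thesis
  proof
    show "norm ((\<psi> - G) - \<psi>) \<le> \<beta>"
      using assms(4) g_bound by (auto intro!: norm_blinfun_bound simp: G)
    fix v assume "v \<in> D"
    then have "\<psi> (v - z) \<le> g (v - z)" using g(3) K_I[of 1 v] by simp
    then show "(\<psi> - G) v \<le> (\<psi> - G) z"
      using linear_diff[OF g(1), of v z] by (simp add: blinfun.diff_left blinfun.diff_right G)
  qed (use z near in auto)
qed

section \<open>Slices\<close>

lemma bdd_above_blinfun_image:
  fixes \<phi> :: "'a::real_normed_vector \<Rightarrow>\<^sub>L real"
  assumes "bounded A" shows "bdd_above (\<phi> ` A)"
  using bounded_linear_image[OF assms blinfun.bounded_linear_right] by (rule bounded_imp_bdd_above)

lemma slice_mono: "s \<le> t \<Longrightarrow> slice A \<phi> s \<subseteq> slice A \<phi> t"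
  by (auto simp: slice_def)

text \<open>Pairwise distances avoid \<open>diameter\<close> on possibly unbounded images; a uniform
  bound on them already yields boundedness. One width \<open>t\<close> is enough, since thinner
  slices are smaller.\<close>

definition slice_oscillation_le ::
    "('a::real_normed_vector \<Rightarrow> 'b::metric_space) \<Rightarrow> 'a set \<Rightarrow> real \<Rightarrow> ('a \<Rightarrow>\<^sub>L real) set" where
  "slice_oscillation_le f A \<epsilon> =
     {\<phi>. \<exists>t>0. \<forall>u\<in>slice A \<phi> t. \<forall>v\<in>slice A \<phi> t. dist (f u) (f v) \<le> \<epsilon>}"

lemma diameter_le_dist:
  fixes S :: "'b::metric_space set"
  assumes "0 \<le> d" "\<And>x y. x \<in> S \<Longrightarrow> y \<in> S \<Longrightarrow> dist x y \<le> d"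
  shows "diameter S \<le> d"
  using assms by (auto simp: diameter_def intro!: cSUP_least)

text \<open>Slices shrink with \<open>t\<close>, so a limit 0 of the diameters amounts to one slice
  of small oscillation for each bound \<open>1 / real (Suc n)\<close>. This is the countable
  intersection needed for Baire's theorem.\<close>

lemma SS_eq_Inter: "SS f A = (\<Inter>n. slice_oscillation_le f A (1 / real (Suc n)))"
proof (intro equalityI subsetI INT_I)
  fix \<phi> n assume "\<phi> \<in> SS f A"
  then have bd: "\<forall>\<^sub>F t in at_right 0. bounded (f ` slice A \<phi> t)"
    and lim: "((\<lambda>t. diameter (f ` slice A \<phi> t)) \<longlongrightarrow> 0) (at_right 0)"
    by (auto simp: SS_def strongly_slicing_def)
  have "\<forall>\<^sub>F t in at_right 0. diameter (f ` slice A \<phi> t) < 1 / real (Suc n)"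
    using order_tendstoD(2)[OF lim] by simp
  with bd have "\<forall>\<^sub>F t in at_right 0. bounded (f ` slice A \<phi> t) \<and>
      diameter (f ` slice A \<phi> t) < 1 / real (Suc n) \<and> t > 0"
    using eventually_at_right_less[of "0::real"] by eventually_elim auto
  then obtain t where t: "bounded (f ` slice A \<phi> t)" "diameter (f ` slice A \<phi> t) < 1 / real (Suc n)"
      "t > 0"
    using eventually_happens'[OF trivial_limit_at_right_real] by blast
  have "dist (f u) (f v) \<le> 1 / real (Suc n)" if "u \<in> slice A \<phi> t" "v \<in> slice A \<phi> t" for u v
    using diameter_bounded_bound[OF t(1), of "f u" "f v"] that t(2) by auto
  then show "\<phi> \<in> slice_oscillation_le f A (1 / real (Suc n))"
    using t(3) by (auto simp: slice_oscillation_le_def)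
next
  fix \<phi> assume \<phi>: "\<phi> \<in> (\<Inter>n. slice_oscillation_le f A (1 / real (Suc n)))"
  have ev: "\<forall>\<^sub>F t in at_right 0. bounded (f ` slice A \<phi> t) \<and> 0 \<le> diameter (f ` slice A \<phi> t)
      \<and> diameter (f ` slice A \<phi> t) < e"
    if "e > 0" for e
  proof -
    obtain n where n: "1 / real (Suc n) < e" using nat_approx_posE[OF \<open>e > 0\<close>] by blast
    obtain s where s: "s > 0"
      "\<And>u v. u \<in> slice A \<phi> s \<Longrightarrow> v \<in> slice A \<phi> s \<Longrightarrow> dist (f u) (f v) \<le> 1 / real (Suc n)"
      using INT_D[OF \<phi>, of n] unfolding slice_oscillation_le_def by blast
    show ?thesis
      unfolding eventually_at_right_field
    proof (intro exI[of _ s] conjI allI impI)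
      fix t :: real assume "0 < t" "t < s"
      then have osc: "dist x y \<le> 1 / real (Suc n)"
        if "x \<in> f ` slice A \<phi> t" "y \<in> f ` slice A \<phi> t" for x y
        using that slice_mono[of t s A \<phi>] s(2) by (metis imageE less_imp_le subsetD)
      then show "bounded (f ` slice A \<phi> t)" unfolding bounded_two_points by blast
      then show "0 \<le> diameter (f ` slice A \<phi> t)" by (rule diameter_ge_0)
      have "diameter (f ` slice A \<phi> t) \<le> 1 / real (Suc n)"
        by (rule diameter_le_dist) (use osc in auto)
      then show "diameter (f ` slice A \<phi> t) < e" using n by simp
    qed (use s in auto)
  qed
  have "((\<lambda>t. diameter (f ` slice A \<phi> t)) \<longlongrightarrow> 0) (at_right 0)"
  proof (rule tendstoI)
    fix e :: real assume "e > 0"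
    from ev[OF this] show "\<forall>\<^sub>F t in at_right 0. dist (diameter (f ` slice A \<phi> t)) 0 < e"
      by eventually_elim simp
  qed
  moreover have "\<forall>\<^sub>F t in at_right 0. bounded (f ` slice A \<phi> t)"
    using ev[of 1] by (auto elim: eventually_mono)
  ultimately show "\<phi> \<in> SS f A"
    by (simp add: SS_def strongly_slicing_def)
qed

text \<open>With \<open>A\<close> in the ball of radius \<open>R\<close>, functionals closer than
  \<open>t / (3 * R)\<close> differ by at most \<open>t / 3\<close> on \<open>A\<close>. The change
  of the values, the change of the supremum and the new width cost \<open>t / 3\<close> each, so the
  slice of width \<open>t / 3\<close> of the new functional stays inside the old one.\<close>

lemma open_slice_oscillation_le:
  assumes "bounded A" "A \<noteq> {}"
  shows "open (slice_oscillation_le f A \<epsilon>)"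
  unfolding open_dist
proof
  fix \<phi> assume "\<phi> \<in> slice_oscillation_le f A \<epsilon>"
  then obtain t where t: "t > 0"
    "\<And>u v. u \<in> slice A \<phi> t \<Longrightarrow> v \<in> slice A \<phi> t \<Longrightarrow> dist (f u) (f v) \<le> \<epsilon>"
    by (auto simp: slice_oscillation_le_def)
  obtain R where R: "R > 0" "\<And>x. x \<in> A \<Longrightarrow> norm x \<le> R"
    using assms(1) by (meson bounded_pos)
  have "\<psi> \<in> slice_oscillation_le f A \<epsilon>" if \<psi>: "dist \<psi> \<phi> < t / (3 * R)" for \<psi>
  proof -
    have close: "\<bar>\<psi> x - \<phi> x\<bar> \<le> t / 3" if "x \<in> A" for x
    proof -
      have "\<bar>\<psi> x - \<phi> x\<bar> \<le> norm (\<psi> - \<phi>) * norm x"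
        using norm_blinfun[of "\<psi> - \<phi>" x] by (simp add: blinfun.diff_left)
      also have "\<dots> \<le> t / (3 * R) * R"
        using \<psi> R(2)[OF that] R(1) t(1) by (intro mult_mono) (auto simp: dist_norm)
      finally show ?thesis using R(1) by simp
    qed
    have sup_le: "(SUP y\<in>A. \<phi> y) \<le> (SUP y\<in>A. \<psi> y) + t / 3"
    proof (rule cSUP_least[OF assms(2)])
      fix x assume x: "x \<in> A"
      have "\<psi> x \<le> (SUP y\<in>A. \<psi> y)" by (rule cSUP_upper[OF x bdd_above_blinfun_image[OF assms(1)]])
      then show "\<phi> x \<le> (SUP y\<in>A. \<psi> y) + t / 3" using close[OF x] by linarith
    qed
    have "slice A \<psi> (t / 3) \<subseteq> slice A \<phi> t"
    proof (intro subsetI)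
      fix x assume x: "x \<in> slice A \<psi> (t / 3)"
      then have xA: "x \<in> A" and "(SUP y\<in>A. \<psi> y) - t / 3 < \<psi> x" by (auto simp: slice_def)
      then have "(SUP y\<in>A. \<phi> y) - t < \<phi> x"
        using close[OF xA] sup_le by linarith
      then show "x \<in> slice A \<phi> t" using xA by (simp add: slice_def)
    qed
    then show ?thesis using t
      by (auto simp: slice_oscillation_le_def intro!: exI[of _ "t / 3"])
  qed
  then show "\<exists>e>0. \<forall>\<psi>. dist \<psi> \<phi> < e \<longrightarrow> \<psi> \<in> slice_oscillation_le f A \<epsilon>"
    using t R by (intro exI[of _ "t / (3 * R)"]) auto
qed

text \<open>The closed half-space below the supremum over \<open>A\<close> is convex, so it contains
  the closed convex hull, and the supremum does not grow. Hence an oscillation bound on the hull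
  passes to \<open>A\<close>.\<close>

lemma slice_subset_slice_closure_hull:
  fixes \<phi> :: "'a::real_normed_vector \<Rightarrow>\<^sub>L real"
  assumes "bounded A" "A \<noteq> {}"
  shows "slice A \<phi> t \<subseteq> slice (closure (convex hull A)) \<phi> t"
proof -
  let ?s = "SUP y\<in>A. \<phi> y"
  have "closed {x. \<phi> x \<le> ?s}" by (intro closed_Collect_le continuous_intros)
  moreover have "convex {x. \<phi> x \<le> ?s}"
    using convex_linear_vimage[OF bounded_linear.linear[OF blinfun.bounded_linear_right] convex_real_interval(2)[of ?s]]
    by (simp add: vimage_def)
  moreover have "A \<subseteq> {x. \<phi> x \<le> ?s}"
    using cSUP_upper[OF _ bdd_above_blinfun_image[OF assms(1)]] by auto
  ultimately have "closure (convex hull A) \<subseteq> {x. \<phi> x \<le> ?s}"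
    by (intro closure_minimal hull_minimal) auto
  then have "(SUP y\<in>closure (convex hull A). \<phi> y) \<le> ?s"
    using assms(2) by (intro cSUP_least) auto
  moreover have "A \<subseteq> closure (convex hull A)"
    by (rule subset_trans[OF hull_subset closure_subset])
  ultimately show ?thesis by (force simp: slice_def)
qed

section \<open>Density\<close>

lemma exists_near_functional_small_slice:
  fixes D :: "'a::banach set" and f :: "'a \<Rightarrow> 'b::metric_space"
  assumes D: "closed D" "convex D" "bounded D" "D \<noteq> {}"
    and dent: "dentable_on D f" and uc: "uniformly_continuous_on D f"
    and "\<delta> > 0" "\<epsilon> > 0"
  shows "\<exists>\<psi>\<in>slice_oscillation_le f D \<epsilon>. dist \<psi> \<xi> < \<delta>"
proof -
  define S where "S = {z\<in>D. \<exists>y. norm (y - \<xi>) < \<delta> \<and> (\<forall>v\<in>D. blinfun_apply y v \<le> y z)}"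
  have bdd: "bdd_above (y ` D)" for y :: "'a \<Rightarrow>\<^sub>L real" by (rule bdd_above_blinfun_image[OF D(3)])
  have upper: "y v \<le> (SUP x\<in>D. y x)" if "v \<in> D" for y :: "'a \<Rightarrow>\<^sub>L real" and v
    by (rule cSUP_upper[OF that bdd])
  \<comment> \<open>The Bishop-Phelps-Bollobas functional is within \<open>\<beta>\<close> of
    \<open>y\<close>, so the margin in the hypothesis keeps it in the ball around
    \<open>\<xi>\<close> and its maximum point lies in \<open>S\<close>.\<close>
  have approx: "\<exists>z\<in>S. norm (z - w) \<le> \<beta>"
    if w: "w \<in> slice D y (\<beta>\<^sup>2)" and \<beta>: "\<beta> > 0" "norm (y - \<xi>) + \<beta> < \<delta>" for w y \<beta>
  proof -
    have "w \<in> D" "y v \<le> y w + \<beta>\<^sup>2" if "v \<in> D" for v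
      using w upper[OF that, of y] by (auto simp: slice_def)
    then have wD: "w \<in> D" and ws: "\<And>v. v \<in> D \<Longrightarrow> y v \<le> y w + \<beta>\<^sup>2" using D(4) by auto
    obtain z \<phi> where z: "z \<in> D" "norm (z - w) \<le> \<beta>" "norm (\<phi> - y) \<le> \<beta>"
      "\<And>v. v \<in> D \<Longrightarrow> blinfun_apply \<phi> v \<le> \<phi> z"
      using bishop_phelps_bollobas[OF D(1,2) wD \<beta>(1) ws] by blast
    have "norm (\<phi> - \<xi>) < \<delta>"
      using norm_triangle_ineq[of "\<phi> - y" "y - \<xi>"] z(3) \<beta>(2) by simp
    then show ?thesis using z by (auto simp: S_def)
  qed
  have slice_ne: "slice D y t \<noteq> {}" if "t > 0" for y t
  proof -
    have "(SUP x\<in>D. y x) - t < (SUP x\<in>D. y x)" using that by simp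
    then show ?thesis using less_cSUP_iff[OF D(4) bdd] by (auto simp: slice_def)
  qed
  have "S \<noteq> {}"
    using approx[of _ \<xi> "\<delta>/2"] slice_ne[of "(\<delta>/2)\<^sup>2" \<xi>] \<open>\<delta> > 0\<close> by fastforce
  moreover have SD: "S \<subseteq> D" by (auto simp: S_def)
  moreover have "bounded S" using bounded_subset[OF D(3) SD] .
  ultimately obtain H where H: "open_half_space H" "S \<inter> H \<noteq> {}" "bounded (f ` (S \<inter> H))"
      "diameter (f ` (S \<inter> H)) < \<epsilon> / 3"
    using dent \<open>\<epsilon> > 0\<close> unfolding dentable_on_def by (metis divide_pos_pos zero_less_numeral)
  obtain \<phi> :: "'a \<Rightarrow>\<^sub>L real" and a where Ha: "H = {x. \<phi> x > a}"
    using H(1) by (auto simp: open_half_space_def)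
  obtain z y where z: "z \<in> D" "\<phi> z > a" and y: "norm (y - \<xi>) < \<delta>" "\<And>v. v \<in> D \<Longrightarrow> blinfun_apply y v \<le> y z"
    using H(2) by (auto simp: Ha S_def)
  \<comment> \<open>The factor 2 makes \<open>y'\<close> stay strictly inside the ball; adding 1
    avoids division by 0 when \<open>\<phi> = 0\<close>.\<close>
  define \<eta> where "\<eta> = (\<delta> - norm (y - \<xi>)) / (2 * (norm \<phi> + 1))"
  \<comment> \<open>Half the height of \<open>z\<close> above the hyperplane is lost on passing to a
    point of the slice, the other half on passing to a nearby point of \<open>S\<close>.\<close>
  define \<gamma> where "\<gamma> = (\<phi> z - a) / 2"
  define y' where "y' = y + \<eta> *\<^sub>R \<phi>"
  have pos: "norm \<phi> + 1 > 0" by (simp add: add_nonneg_pos)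
  have \<eta>: "\<eta> > 0" using y pos by (simp add: \<eta>_def)
  have \<gamma>: "\<gamma> > 0" using z by (simp add: \<gamma>_def)
  have "\<eta> * norm \<phi> < \<eta> * (2 * (norm \<phi> + 1))"
    by (rule mult_strict_left_mono[OF _ \<eta>]) (simp add: add_nonneg_pos)
  also have "\<dots> = \<delta> - norm (y - \<xi>)" using pos by (simp add: \<eta>_def)
  finally have "norm (y - \<xi>) + \<eta> * norm \<phi> < \<delta>" by simp
  moreover have "norm (y' - \<xi>) \<le> norm (y - \<xi>) + \<eta> * norm \<phi>"
    using norm_triangle_ineq[of "y - \<xi>" "\<eta> *\<^sub>R \<phi>"] \<eta> by (simp add: y'_def algebra_simps)
  ultimately have y': "norm (y' - \<xi>) < \<delta>" by linarith
  obtain d where d: "d > 0" "\<And>u v. u \<in> D \<Longrightarrow> v \<in> D \<Longrightarrow> dist v u < d \<Longrightarrow> dist (f v) (f u) < \<epsilon> / 3"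
    using uc \<open>\<epsilon> > 0\<close> unfolding uniformly_continuous_on_def by (metis divide_pos_pos zero_less_numeral)
  \<comment> \<open>The three bounds serve uniform continuity, the margin in \<open>approx\<close>,
    and a change of \<open>\<phi>\<close> by at most \<open>\<gamma>\<close> over distance
    \<open>\<beta>\<close>.\<close>
  define \<beta> where "\<beta> = min (d / 2) (min ((\<delta> - norm (y' - \<xi>)) / 2) (\<gamma> / (norm \<phi> + 1)))"
  have "\<beta> < d" using d(1) by (simp add: \<beta>_def min_less_iff_disj)
  moreover have "\<beta> > 0" using d(1) y' \<gamma> pos by (simp add: \<beta>_def)
  moreover have "\<beta> < \<delta> - norm (y' - \<xi>)" using y' by (simp add: \<beta>_def min_less_iff_disj)
  ultimately have \<beta>: "\<beta> > 0" "\<beta> < d" "norm (y' - \<xi>) + \<beta> < \<delta>"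
    by simp_all
  have "\<beta> * (norm \<phi> + 1) \<le> \<gamma> / (norm \<phi> + 1) * (norm \<phi> + 1)"
    using pos by (intro mult_right_mono) (auto simp: \<beta>_def)
  also have "\<dots> = \<gamma>" using pos by simp
  finally have \<beta>\<gamma>: "norm \<phi> * \<beta> \<le> \<gamma>" using \<beta>(1) by (simp add: algebra_simps)
  \<comment> \<open>The bound \<open>\<eta> * \<gamma>\<close> keeps \<open>\<phi>\<close> above
    \<open>\<phi> z - \<gamma>\<close> on the slice; the bound \<open>\<beta>\<^sup>2\<close> allows
    the use of \<open>approx\<close>.\<close>
  define t where "t = min (\<eta> * \<gamma>) (\<beta>\<^sup>2)"
  have t: "t > 0" using \<eta> \<gamma> \<beta> by (simp add: t_def)
  have near: "\<exists>w'\<in>S \<inter> H. dist (f w) (f w') < \<epsilon> / 3" if w: "w \<in> slice D y' t" for w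
  proof -
    have wD: "w \<in> D" using w by (simp add: slice_def)
    \<comment> \<open>As \<open>y w \<le> y z\<close>, any value of \<open>y' w\<close> close to
      \<open>y' z\<close> forces \<open>\<phi> w\<close> to be almost as large as
      \<open>\<phi> z\<close>.\<close>
    have "y' z - \<eta> * \<gamma> < y' w"
      using w upper[OF z(1), of y'] min.cobounded1[of "\<eta> * \<gamma>" "\<beta>\<^sup>2"]
      unfolding slice_def t_def mem_Collect_eq by linarith
    then have "\<eta> * (\<phi> z - \<gamma>) < \<eta> * \<phi> w"
      using y(2)[OF wD] by (simp add: y'_def blinfun.add_left blinfun.scaleR_left algebra_simps)
    then have \<phi>w: "\<phi> z - \<gamma> < \<phi> w" using \<eta> by simp
    have "w \<in> slice D y' (\<beta>\<^sup>2)" using w slice_mono[of t "\<beta>\<^sup>2"] by (auto simp: t_def)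
    then obtain w' where w': "w' \<in> S" "norm (w' - w) \<le> \<beta>" using approx \<beta> by blast
    have "\<bar>\<phi> (w' - w)\<bar> \<le> norm \<phi> * norm (w' - w)" using norm_blinfun[of \<phi> "w' - w"] by simp
    also have "\<dots> \<le> norm \<phi> * \<beta>" using w'(2) by (intro mult_left_mono) auto
    finally have "\<phi> w - \<gamma> \<le> \<phi> w'" using \<beta>\<gamma> by (simp add: blinfun.diff_right)
    then have "w' \<in> H" using \<phi>w by (simp add: Ha \<gamma>_def field_simps)
    moreover have "dist (f w) (f w') < \<epsilon> / 3"
      using d(2)[of w' w] w' wD SD \<beta>(2) by (auto simp: dist_norm norm_minus_commute)
    ultimately show ?thesis using w'(1) by blast
  qed
  have "dist (f u) (f v) \<le> \<epsilon>" if uv: "u \<in> slice D y' t" "v \<in> slice D y' t" for u v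
  proof -
    obtain u' where u': "u' \<in> S \<inter> H" "dist (f u) (f u') < \<epsilon> / 3" using near uv by blast
    obtain v' where v': "v' \<in> S \<inter> H" "dist (f v) (f v') < \<epsilon> / 3" using near uv by blast
    have "dist (f u') (f v') < \<epsilon> / 3"
      using diameter_bounded_bound[OF H(3), of "f u'" "f v'"] u' v' H(4) by auto
    then show ?thesis
      using u' v' dist_triangle[of "f u" "f v" "f u'"] dist_triangle[of "f u'" "f v" "f v'"]
      by (simp add: dist_commute)
  qed
  then have "y' \<in> slice_oscillation_le f D \<epsilon>" using t by (auto simp: slice_oscillation_le_def)
  then show ?thesis using y' by (auto simp: dist_norm)
qed

lemma dentable_on_subset: "dentable_on C f \<Longrightarrow> D \<subseteq> C \<Longrightarrow> dentable_on D f"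
  unfolding dentable_on_def by (meson order_trans)

lemma closure_Inter_open_dense:
  fixes U :: "nat \<Rightarrow> 'a::complete_space set"
  assumes "\<And>n. open (U n)" "\<And>n. closure (U n) = UNIV"
  shows "closure (\<Inter>n. U n) = UNIV"
proof -
  have "Met_TC.mtopology closure_of (\<Inter>(range U)) = (UNIV :: 'a set)"
    by (rule Met_TC.metric_Baire_category)
       (use assms in \<open>auto simp: mcomplete_iff_complete complete_UNIV\<close>)
  then show ?thesis by simp
qed

theorem theorem2p7:
  fixes C :: "'a::banach set" and f :: "'a \<Rightarrow> 'b::metric_space"
  assumes "closed C" and "convex C"
    and "dentable_on C f"
    and "\<And>B. B \<subseteq> C \<Longrightarrow> bounded B \<Longrightarrow> uniformly_continuous_on B f"
  shows "\<forall>A. A \<noteq> {} \<and> bounded A \<and> A \<subseteq> C \<longrightarrow>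
           closure (SS f A) = UNIV \<and> gdelta_in euclidean (SS f A)"
proof (intro allI impI)
  fix A assume "A \<noteq> {} \<and> bounded A \<and> A \<subseteq> C"
  then have A: "A \<noteq> {}" "bounded A" "A \<subseteq> C" by auto
  \<comment> \<open>The closed convex set \<open>C\<close> contains this hull, so dentability and
    uniform continuity are available on \<open>D\<close>.\<close>
  define D where "D = closure (convex hull A)"
  have D: "closed D" "convex D" "bounded D" "D \<noteq> {}" "D \<subseteq> C"
    using A assms(1,2)
    by (auto simp: D_def convex_closure bounded_closure bounded_convex_hull closure_minimal hull_minimal)
  let ?U = "\<lambda>n. slice_oscillation_le f A (1 / real (Suc n))"
  have op: "open (?U n)" for n by (rule open_slice_oscillation_le[OF A(2,1)])
  have "closure (?U n) = UNIV" for n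
  proof -
    have "slice_oscillation_le f D (1 / real (Suc n)) \<subseteq> ?U n"
      using slice_subset_slice_closure_hull[OF A(2,1)]
      unfolding slice_oscillation_le_def D_def by blast
    then have "\<exists>\<psi>\<in>?U n. dist \<psi> \<xi> < \<delta>" if "\<delta> > 0" for \<xi> \<delta>
      using exists_near_functional_small_slice[OF D(1-4) dentable_on_subset[OF assms(3) D(5)]
          assms(4)[OF D(5,3)] that, of "1 / real (Suc n)" \<xi>] by auto
    then show ?thesis by (auto simp: closure_approachable)
  qed
  then have "closure (SS f A) = UNIV"
    unfolding SS_eq_Inter by (intro closure_Inter_open_dense op)
  moreover have "gdelta_in euclidean (SS f A)"
    unfolding SS_eq_Inter using op by (intro gdelta_in_Inter) (auto intro: open_imp_gdelta_in)
  ultimately show "closure (SS f A) = UNIV \<and> gdelta_in euclidean (SS f A)" by blast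
qed

end
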